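(* For every integer $n\ge 2$, the following hold: (i) $\rho_2(Q_n)\ge 2^{\,n-\lfloor \log_2 n\rfloor-1}$, and (ii) $\rho^{\rm o}(Q_n)\ge 2^{\,n-\lfloor \log_2 (n-1)\rfloor-1}$.
   Context: For a vertex $x$ of a graph $G$, $N(x)$ is the set of vertices adjacent to $x$ and $N[x]=N(x)\cup\{x\}$. A set $X\subseteq V(G)$ is a $2$-packing of $G$ if $N[x]\cap N[y]=\emptyset$ for every pair of distinct $x,y\in X$; $\rho_2(G)$ is the maximum cardinality of a $2$-packing of $G$. A set $X\subseteq V(G)$ is an open packing of $G$ if $N(x)\cap N(y)=\emptyset$ for every pair of distinct $x,y\in X$ (two vertices of an open packing may be adjacent); $\rho^{\rm o}(G)$ is the maximum cardinality of an open packing of $G$. $Q_n$ is the $n$-dimensional hypercube: its vertices are the binary strings of length $n$, and two are adjacent if they differ in exactly one coordinate. *)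

theory Defs
  imports Complex_Main "Graph_Theory.Pair_Digraph"
begin

text \<open>
  Simple graphs are the symmetric loop-free digraphs \<^locale>\<open>pair_graph\<close>:
  an undirected edge is the pair of arcs \<open>(u, v)\<close> and \<open>(v, u)\<close>.
\<close>

definition nbhd :: "'a pair_pre_digraph \<Rightarrow> 'a \<Rightarrow> 'a set" where
  "nbhd G x = {y \<in> pverts G. (x, y) \<in> parcs G}"

definition closed_nbhd :: "'a pair_pre_digraph \<Rightarrow> 'a \<Rightarrow> 'a set" where
  "closed_nbhd G x = nbhd G x \<union> {x}"

definition two_packing :: "'a pair_pre_digraph \<Rightarrow> 'a set \<Rightarrow> bool" where
  "two_packing G X \<longleftrightarrow> X \<subseteq> pverts G \<and>
     (\<forall>x\<in>X. \<forall>y\<in>X. x \<noteq> y \<longrightarrow> closed_nbhd G x \<inter> closed_nbhd G y = {})"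

definition open_packing :: "'a pair_pre_digraph \<Rightarrow> 'a set \<Rightarrow> bool" where
  "open_packing G X \<longleftrightarrow> X \<subseteq> pverts G \<and>
     (\<forall>x\<in>X. \<forall>y\<in>X. x \<noteq> y \<longrightarrow> nbhd G x \<inter> nbhd G y = {})"

text \<open>
  The two maxima below are meaningful for finite graphs: the sets of cardinalities are
  then finite, and they contain 0 because the empty set is a packing.
\<close>

definition two_packing_number :: "'a pair_pre_digraph \<Rightarrow> nat" where
  "two_packing_number G = Max {card X | X. two_packing G X}"

definition open_packing_number :: "'a pair_pre_digraph \<Rightarrow> nat" where
  "open_packing_number G = Max {card X | X. open_packing G X}"

definition hypercube :: "nat \<Rightarrow> bool list pair_pre_digraph" where
  "hypercube n =
     \<lparr> pverts = {u. length u = n},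
       parcs = {(u, v). length u = n \<and> length v = n \<and> card {i. i < n \<and> u ! i \<noteq> v ! i} = 1} \<rparr>"

lemma finite_hypercube_verts: "finite (pverts (hypercube n))"
  using finite_lists_length_eq[of "UNIV :: bool set" n] by (simp add: hypercube_def)

lemma pair_graph_hypercube: "pair_graph (hypercube n)"
proof
  show "finite (pverts (hypercube n))"
    by (rule finite_hypercube_verts)
  have "parcs (hypercube n) \<subseteq> pverts (hypercube n) \<times> pverts (hypercube n)"
    by (auto simp: hypercube_def)
  then show "finite (parcs (hypercube n))"
    using finite_hypercube_verts by (meson finite_SigmaI finite_subset)
  have "(v, u) \<in> parcs (hypercube n)" if "(u, v) \<in> parcs (hypercube n)" for u v
  proof -
    have "{i. i < n \<and> v ! i \<noteq> u ! i} = {i. i < n \<and> u ! i \<noteq> v ! i}"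
      by (rule Collect_cong) auto
    with that show ?thesis
      by (simp only: hypercube_def pair_pre_digraph.simps mem_Collect_eq case_prod_conv simp_thms)
  qed
  then have "sym (parcs (hypercube n))"
    by (rule symI)
  then show "symmetric (with_proj (hypercube n))"
    by (simp only: symmetric_def with_proj_simps)
next
  fix e
  assume "e \<in> parcs (hypercube n)"
  then have e: "length (fst e) = n" "length (snd e) = n"
    "card {i. i < n \<and> fst e ! i \<noteq> snd e ! i} = 1"
    unfolding hypercube_def by (simp_all add: case_prod_beta)
  show "fst e \<in> pverts (hypercube n)" "snd e \<in> pverts (hypercube n)"
    unfolding hypercube_def using e(1,2) by simp_all
  show "fst e \<noteq> snd e"
  proof
    assume "fst e = snd e"
    then have "{i. i < n \<and> fst e ! i \<noteq> snd e ! i} = {}"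
      by simp
    with e(3) show False
      by (metis card.empty zero_neq_one)
  qed
qed

lemma finite_packing_cards:
  assumes "finite (pverts G)"
  shows "finite {card X | X. two_packing G X}" "finite {card X | X. open_packing G X}"
proof -
  have "finite (card ` Pow (pverts G))"
    using assms by simp
  moreover have "{card X | X. two_packing G X} \<subseteq> card ` Pow (pverts G)"
    "{card X | X. open_packing G X} \<subseteq> card ` Pow (pverts G)"
    by (auto simp: two_packing_def open_packing_def)
  ultimately show "finite {card X | X. two_packing G X}" "finite {card X | X. open_packing G X}"
    by (meson finite_subset)+
qed

end

theory Submission
  imports Defs
begin

text \<open>
  Shortened Hamming codes. The coordinates of a string are labelled by consecutive numbers
  below \<open>2 ^ m\<close>, and the syndrome of a string is the bitwise XOR of the labels of its ones.
  Flipping a coordinate changes the syndrome by its label. Two neighbours of a common vertex with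
  the same syndrome are therefore equal because labels are distinct, so every fibre of the syndrome
  is an open packing. If all labels are nonzero, adjacent vertices have different syndromes as well
  and fibres are 2-packings. By the pigeonhole principle some fibre has at least
  \<open>2 ^ n / 2 ^ m\<close> elements.
\<close>

unbundle bit_operations_syntax

text \<open>\<open>k\<close> labels the first coordinate. Starting at 1 makes all labels nonzero, as
  in a Hamming code; starting at 0 fits one more coordinate below the same power of two.\<close>

fun syndrome :: "nat \<Rightarrow> bool list \<Rightarrow> nat" where
  "syndrome k [] = 0"
| "syndrome k (b # u) = (if b then k else 0) XOR syndrome (Suc k) u"

text \<open>A number is below \<open>2 ^ m\<close> iff \<open>take_bit m\<close> fixes it, and
  \<open>take_bit m\<close> commutes with XOR.\<close>

lemma xor_nat_less_power:
  fixes a b :: nat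
  assumes "a < 2 ^ m" "b < 2 ^ m"
  shows "a XOR b < 2 ^ m"
  using assms by (simp flip: take_bit_nat_eq_self_iff)

lemma xor_self_left:
  fixes a b :: nat
  shows "a XOR (a XOR b) = b"
  by (simp flip: xor.assoc)

lemma syndrome_less:
  "k + length u \<le> 2 ^ m \<Longrightarrow> syndrome k u < 2 ^ m"
  by (induction u arbitrary: k) (auto intro!: xor_nat_less_power)

lemma syndrome_flip:
  "i < length u \<Longrightarrow> syndrome k (u[i := \<not> u ! i]) = syndrome k u XOR (k + i)"
proof (induction u arbitrary: i k)
  case (Cons b u)
  then show ?case
    by (cases i) (auto simp: ac_simps xor_self_left)
qed simp

text \<open>The centre \<open>x\<close> is written as a flip of its neighbour \<open>z\<close>, so
  that two vertices with common neighbour \<open>z\<close> become flips of the same string.\<close>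

lemma hypercube_nbhdE:
  assumes "z \<in> nbhd (hypercube n) x"
  obtains i where "i < n" "length z = n" "x = z[i := \<not> z ! i]"
proof -
  from assms have len: "length x = n" "length z = n"
    and "card {i. i < n \<and> x ! i \<noteq> z ! i} = 1"
    by (auto simp: nbhd_def hypercube_def)
  then obtain i where i: "{i. i < n \<and> x ! i \<noteq> z ! i} = {i}"
    by (auto simp: card_1_singleton_iff)
  then have "i < n" "\<And>j. j < n \<Longrightarrow> (x ! j \<noteq> z ! j) = (j = i)"
    by blast+
  moreover from this have "x = z[i := \<not> z ! i]"
    using len by (intro nth_equalityI) (auto simp: nth_list_update)
  ultimately show thesis
    using that len by blast
qed

definition syndrome_fibre :: "nat \<Rightarrow> nat \<Rightarrow> nat \<Rightarrow> bool list set" where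
  "syndrome_fibre k n s = {u. length u = n \<and> syndrome k u = s}"

lemma syndrome_fibre_common_nbhd:
  assumes "x \<in> syndrome_fibre k n s" "y \<in> syndrome_fibre k n s"
    and "z \<in> nbhd (hypercube n) x" "z \<in> nbhd (hypercube n) y"
  shows "x = y"
proof -
  obtain i where i: "i < n" "length z = n" "x = z[i := \<not> z ! i]"
    using assms(3) by (rule hypercube_nbhdE)
  obtain j where j: "j < n" "y = z[j := \<not> z ! j]"
    using assms(4) by (rule hypercube_nbhdE)
  have "syndrome k z XOR (k + i) = syndrome k z XOR (k + j)"
    using assms(1,2) i j syndrome_flip[of _ z k] by (auto simp: syndrome_fibre_def)
  \<comment> \<open>XOR with \<open>syndrome k z\<close> once more cancels it and leaves
    \<open>k + i = k + j\<close>.\<close>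
  then have "syndrome k z XOR (syndrome k z XOR (k + i)) = syndrome k z XOR (syndrome k z XOR (k + j))"
    by (rule arg_cong)
  then have "i = j"
    by (simp add: xor_self_left)
  with i j show ?thesis
    by simp
qed

lemma syndrome_fibre_not_adjacent:
  assumes "x \<in> syndrome_fibre k n s" "y \<in> syndrome_fibre k n s" "0 < k"
  shows "y \<notin> nbhd (hypercube n) x"
proof
  assume "y \<in> nbhd (hypercube n) x"
  then obtain i where i: "i < n" "length y = n" "x = y[i := \<not> y ! i]"
    by (rule hypercube_nbhdE)
  then have "s = s XOR (k + i)"
    using assms(1,2) syndrome_flip[of i y k] by (auto simp: syndrome_fibre_def)
  \<comment> \<open>Cancelling \<open>s\<close> leaves \<open>0 = k + i\<close>, impossible for
    positive \<open>k\<close>.\<close>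
  then have "s XOR s = s XOR (s XOR (k + i))"
    by (rule arg_cong)
  with assms(3) show False
    by (simp add: xor_self_left)
qed

lemma open_packing_syndrome_fibre:
  "open_packing (hypercube n) (syndrome_fibre k n s)"
  unfolding open_packing_def
  using syndrome_fibre_common_nbhd by (fastforce simp: syndrome_fibre_def hypercube_def)

lemma two_packing_syndrome_fibre:
  assumes "0 < k"
  shows "two_packing (hypercube n) (syndrome_fibre k n s)"
proof -
  have "syndrome_fibre k n s \<subseteq> pverts (hypercube n)"
    by (auto simp: syndrome_fibre_def hypercube_def)
  \<comment> \<open>A common point of two closed neighbourhoods is a common neighbour or one of the
    two centres, adjacent to the other.\<close>
  then show ?thesis
    using syndrome_fibre_common_nbhd[of _ k n s] syndrome_fibre_not_adjacent[of _ k n s] assms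
    unfolding two_packing_def closed_nbhd_def by blast
qed

text \<open>Since all labels are below \<open>2 ^ m\<close>, so are all syndromes, and the
  \<open>2 ^ m\<close> fibres partition the \<open>2 ^ n\<close> strings. With
  \<open>m \<le> n\<close> the average fibre size is exactly \<open>2 ^ (n - m)\<close>.\<close>

lemma ex_large_syndrome_fibre:
  assumes "k + n \<le> 2 ^ m" "m \<le> n"
  obtains s where "2 ^ (n - m) \<le> card (syndrome_fibre k n s)"
proof -
  let ?V = "{u :: bool list. length u = n}"
  have V: "finite ?V" "card ?V = 2 ^ n"
    using finite_lists_length_eq[of "UNIV :: bool set" n] card_lists_length_eq[of "UNIV :: bool set" n]
    by simp_all
  have "card ?V = (\<Sum>s<2 ^ m. card (syndrome_fibre k n s))"
  proof -
    have "?V = (\<Union>s<2 ^ m. syndrome_fibre k n s)"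
      using syndrome_less[of k _ m] assms(1) by (auto simp: syndrome_fibre_def)
    moreover have "finite (syndrome_fibre k n s)" for s
      using V(1) by (rule finite_subset[rotated]) (auto simp: syndrome_fibre_def)
    ultimately show ?thesis
      by (auto simp: syndrome_fibre_def intro!: card_UN_disjoint)
  qed
  then have sum: "(\<Sum>s<2 ^ m. card (syndrome_fibre k n s)) = 2 ^ m * 2 ^ (n - m)"
    using V(2) assms(2) by (simp flip: power_add)
  have "\<exists>s. 2 ^ (n - m) \<le> card (syndrome_fibre k n s)"
  proof (rule ccontr)
    assume "\<nexists>s. 2 ^ (n - m) \<le> card (syndrome_fibre k n s)"
    then have "(\<Sum>s<2 ^ m. card (syndrome_fibre k n s)) < (\<Sum>s<(2 :: nat) ^ m. 2 ^ (n - m))"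
      by (intro sum_strict_mono) (auto simp: not_le lessThan_empty_iff)
    with sum show False
      by simp
  qed
  with that show thesis
    by blast
qed

text \<open>The labels are \<open>1, ..., n\<close>, hence the strict bound on
  \<open>n\<close>.\<close>

lemma two_packing_number_hypercube_ge:
  assumes "n < 2 ^ m" "m \<le> n"
  shows "2 ^ (n - m) \<le> two_packing_number (hypercube n)"
proof -
  obtain s where s: "2 ^ (n - m) \<le> card (syndrome_fibre 1 n s)"
    using assms by (auto intro: ex_large_syndrome_fibre[of 1 n m])
  also have "\<dots> \<le> two_packing_number (hypercube n)"
    unfolding two_packing_number_def
    using finite_packing_cards(1)[OF finite_hypercube_verts] two_packing_syndrome_fibre[of 1 n s]
    by (intro Max_ge) auto
  finally show ?thesis .
qed

text \<open>The labels are \<open>0, ..., n - 1\<close>: a flip at label 0 keeps the syndrome, but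
  an open packing may contain adjacent vertices.\<close>

lemma open_packing_number_hypercube_ge:
  assumes "n \<le> 2 ^ m" "m \<le> n"
  shows "2 ^ (n - m) \<le> open_packing_number (hypercube n)"
proof -
  obtain s where s: "2 ^ (n - m) \<le> card (syndrome_fibre 0 n s)"
    using assms by (auto intro: ex_large_syndrome_fibre[of 0 n m])
  also have "\<dots> \<le> open_packing_number (hypercube n)"
    unfolding open_packing_number_def
    using finite_packing_cards(2)[OF finite_hypercube_verts] open_packing_syndrome_fibre[of n 0 s]
    by (intro Max_ge) auto
  finally show ?thesis .
qed

text \<open>\<open>m\<close> is the number of binary digits of \<open>N\<close>.\<close>

lemma floor_log2_bounds:
  assumes "1 \<le> N"
  obtains m where "\<lfloor>log 2 (real N)\<rfloor> + 1 = int m" "N < 2 ^ m" "m \<le> N"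
proof -
  obtain k where k: "2 ^ k \<le> N" "N < 2 ^ (k + 1)"
    using ex_power_ivl1[of 2 N] assms by auto
  then have "\<lfloor>log 2 (real N)\<rfloor> = int k"
    using floor_log_nat_eq_if[of 2 k N] by simp
  moreover have "k + 1 \<le> N"
    using k(1) less_exp[of k] by linarith
  ultimately show thesis
    using k(2) that[of "k + 1"] by simp
qed

theorem theorem3p2:
  fixes n :: nat
  assumes "n \<ge> 2"
  shows "real (two_packing_number (hypercube n)) \<ge> 2 powi (int n - \<lfloor>log 2 (real n)\<rfloor> - 1)
    \<and> real (open_packing_number (hypercube n)) \<ge> 2 powi (int n - \<lfloor>log 2 (real n - 1)\<rfloor> - 1)"
proof
  have exponent: "2 powi (int n - l - 1) = real (2 ^ (n - m))" if "l + 1 = int m" "m \<le> n" for l m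
  proof -
    have "int n - l - 1 = int (n - m)"
      using that by simp
    then show ?thesis
      by (simp only: power_int_of_nat of_nat_power of_nat_numeral)
  qed
  obtain m where m: "\<lfloor>log 2 (real n)\<rfloor> + 1 = int m" "n < 2 ^ m" "m \<le> n"
    using assms by (auto intro: floor_log2_bounds[of n])
  show "real (two_packing_number (hypercube n)) \<ge> 2 powi (int n - \<lfloor>log 2 (real n)\<rfloor> - 1)"
    unfolding exponent[OF m(1,3)] of_nat_le_iff
    using m(2,3) by (rule two_packing_number_hypercube_ge)
  \<comment> \<open>The digits of \<open>n - 1\<close> are counted here, because
    \<open>n - 1 < 2 ^ m'\<close> is the bound \<open>n \<le> 2 ^ m'\<close> for labels starting at
    0; \<open>n \<ge> 2\<close> keeps the logarithm's argument positive.\<close>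
  obtain m' where m': "\<lfloor>log 2 (real (n - 1))\<rfloor> + 1 = int m'" "n - 1 < 2 ^ m'" "m' \<le> n - 1"
    using assms by (auto intro: floor_log2_bounds[of "n - 1"])
  have "real (n - 1) = real n - 1" "m' \<le> n" "n \<le> 2 ^ m'"
    using assms m'(2,3) by (auto simp: of_nat_diff)
  with m'(1) show "real (open_packing_number (hypercube n)) \<ge> 2 powi (int n - \<lfloor>log 2 (real n - 1)\<rfloor> - 1)"
    using open_packing_number_hypercube_ge[of n m'] exponent[of _ m']
    by (metis of_nat_le_iff)
qed

end
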